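(* Let $S$ be a triangle-free numerical semigroup of maximal embedding dimension. Let $m=m(S)$ be its multiplicity and $F=F(S)$ its Frobenius number, and let $P(S)$ be the number of numerical sets $T$ with $A(T)=S$. (1) Suppose $x,y\in M(S)$ with $x\leq y$. Then $x\preccurlyeq y$ in the void poset $(M(S),\preccurlyeq)$ if and only if $m\mid (y-x)$. (2) If $m$ is odd, then $P(S)=2^{\frac{m-1}{2}}$. (3) If $m$ is even and $F$ is odd, then $P(S)=2^{\frac{m-2}{2}}$. (4) If $m$ and $F$ are both even, then $P(S)=2^{\frac{m}{2}}$.
   Context: A numerical set $T$ is a subset of $\mathbb{N}_0=\{0,1,2,\dots\}$ containing $0$ with finite complement; elements of $\mathbb{N}_0\setminus T$ are its gaps, and its Frobenius number $F(T)$ is the largest gap (defined when $T\ne\mathbb{N}_0$, so here $S\neq\mathbb{N}_0$). A numerical semigroup is a numerical set closed under addition. The atom monoid of $T$ is $A(T)=\{x\in\mathbb{N}_0 \mid x+T\subseteq T\}$. The multiplicity $m(S)$ is the smallest nonzero element of $S$; the embedding dimension $e(S)$ is the cardinality of the unique minimal generating set of $S$ (as an additive monoid); $S$ has maximal embedding dimension if $e(S)=m(S)$. The pseudo-Frobenius numbers of $S$ are $PF(S)=\{P\in \mathbb{N}_0\setminus S \mid P+s\in S \text{ for all } s\in S\setminus\{0\}\}$. The void of $S$ is the set $M(S)$ of gaps $a$ of $S$ such that $F(S)-a$ is also a gap of $S$, partially ordered by $x\preccurlyeq y$ iff $y-x\in S$; this is the void poset. $S$ is triangle-free if whenever $P_1,P_2\in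 PF(S)$ satisfy $P_1-P_2\in M(S)$, then $P_1=F(S)$. *)

theory Defs
  imports Main "HOL.Hull"
begin

definition numerical_set :: "nat set \<Rightarrow> bool" where
  "numerical_set T \<longleftrightarrow> 0 \<in> T \<and> finite (- T)"

definition numerical_semigroup :: "nat set \<Rightarrow> bool" where
  "numerical_semigroup S \<longleftrightarrow> numerical_set S \<and> (\<forall>x\<in>S. \<forall>y\<in>S. x + y \<in> S)"

text \<open>Meaningful only for numerical sets other than \<^term>\<open>UNIV\<close>.\<close>

definition frobenius_number :: "nat set \<Rightarrow> nat" where
  "frobenius_number T = Max (- T)"

definition atom_monoid :: "nat set \<Rightarrow> nat set" where
  "atom_monoid T = {x. (\<lambda>t. x + t) ` T \<subseteq> T}"

definition multiplicity_of :: "nat set \<Rightarrow> nat" where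
  "multiplicity_of S = (LEAST x. x \<in> S \<and> x \<noteq> 0)"

definition submonoid :: "nat set \<Rightarrow> bool" where
  "submonoid M \<longleftrightarrow> 0 \<in> M \<and> (\<forall>x\<in>M. \<forall>y\<in>M. x + y \<in> M)"

definition minimal_generating_set :: "nat set \<Rightarrow> nat set \<Rightarrow> bool" where
  "minimal_generating_set S A \<longleftrightarrow>
     submonoid hull A = S \<and> (\<forall>B. B \<subset> A \<longrightarrow> submonoid hull B \<noteq> S)"

definition embedding_dimension :: "nat set \<Rightarrow> nat" where
  "embedding_dimension S = card (THE A. minimal_generating_set S A)"

definition max_embedding_dimension :: "nat set \<Rightarrow> bool" where
  "max_embedding_dimension S \<longleftrightarrow> embedding_dimension S = multiplicity_of S"

definition pseudo_frobenius :: "nat set \<Rightarrow> nat set" where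
  "pseudo_frobenius S = {P. P \<notin> S \<and> (\<forall>s\<in>S - {0}. P + s \<in> S)}"

text \<open>Every gap is at most the Frobenius number, so the subtraction below does not truncate.\<close>

definition void :: "nat set \<Rightarrow> nat set" where
  "void S = {a. a \<notin> S \<and> frobenius_number S - a \<notin> S}"

text \<open>The order of the void poset. The conjunct \<^term>\<open>x \<le> y\<close> keeps \<^term>\<open>y - x\<close> from
  truncating to \<^term>\<open>0::nat\<close>, which lies in \<^term>\<open>S\<close>.\<close>

definition void_le :: "nat set \<Rightarrow> nat \<Rightarrow> nat \<Rightarrow> bool" where
  "void_le S x y \<longleftrightarrow> x \<le> y \<and> y - x \<in> S"

definition triangle_free :: "nat set \<Rightarrow> bool" where
  "triangle_free S \<longleftrightarrow>
     (\<forall>P1\<in>pseudo_frobenius S. \<forall>P2\<in>pseudo_frobenius S.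
        P2 \<le> P1 \<and> P1 - P2 \<in> void S \<longrightarrow> P1 = frobenius_number S)"

definition num_associated_sets :: "nat set \<Rightarrow> nat" where
  "num_associated_sets S = card {T. numerical_set T \<and> atom_monoid T = S}"

text \<open>The description in \<^const>\<open>embedding_dimension\<close> and the cardinality in
  \<^const>\<open>num_associated_sets\<close> are well defined:\<close>

lemma submonoid_hull: "submonoid (submonoid hull A)"
  unfolding hull_def submonoid_def by blast

lemma ex1_minimal_generating_set:
  assumes "numerical_semigroup S"
  shows "\<exists>!A. minimal_generating_set S A"
proof -
  have S: "submonoid S"
    using assms by (simp add: numerical_semigroup_def numerical_set_def submonoid_def)
  define G where "G = {x \<in> S. x \<noteq> 0 \<and> (\<forall>a\<in>S. \<forall>b\<in>S. x = a + b \<longrightarrow> a = 0 \<or> b = 0)}"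
  have sub: "G \<subseteq> A" if "submonoid hull A = S" for A
  proof
    fix x assume x: "x \<in> G"
    have "A \<subseteq> S" using that hull_subset by metis
    have "submonoid (S - {x})"
      unfolding submonoid_def
    proof (intro conjI ballI)
      show "0 \<in> S - {x}" using S x unfolding submonoid_def G_def by auto
    next
      fix a b assume ab: "a \<in> S - {x}" "b \<in> S - {x}"
      then have "a + b \<in> S" using S unfolding submonoid_def by blast
      moreover have "a + b \<noteq> x"
      proof
        assume "a + b = x"
        then have "a = 0 \<or> b = 0" using x ab unfolding G_def by blast
        then show False using \<open>a + b = x\<close> ab by auto
      qed
      ultimately show "a + b \<in> S - {x}" by blast
    qed
    moreover have "A \<subseteq> S - {x}" if "x \<notin> A" using \<open>A \<subseteq> S\<close> that by blast
    ultimately have "S \<subseteq> S - {x}" if "x \<notin> A"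
      using that \<open>submonoid hull A = S\<close> hull_minimal by metis
    then show "x \<in> A" using x unfolding G_def by blast
  qed
  have in_hull: "x \<in> submonoid hull G" if "x \<in> S" for x
    using that
  proof (induction x rule: less_induct)
    case (less x)
    show ?case
    proof (cases "x = 0 \<or> x \<in> G")
      case True
      then show ?thesis
        using submonoid_hull[of G] hull_subset[of G submonoid] unfolding submonoid_def by auto
    next
      case False
      then obtain a b where ab: "a \<in> S" "b \<in> S" "x = a + b" "a \<noteq> 0" "b \<noteq> 0"
        using less.prems unfolding G_def by blast
      then have "a \<in> submonoid hull G" "b \<in> submonoid hull G"
        using less.IH by auto
      then show ?thesis
        using submonoid_hull[of G] ab(3) unfolding submonoid_def by blast
    qed
  qed
  have "submonoid hull G \<subseteq> S"
    using S by (intro hull_minimal) (auto simp: G_def)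
  then have G: "submonoid hull G = S" using in_hull by blast
  show ?thesis
  proof
    show "minimal_generating_set S G"
      unfolding minimal_generating_set_def using G sub by blast
  next
    fix A assume "minimal_generating_set S A"
    then show "A = G"
      unfolding minimal_generating_set_def using G sub by blast
  qed
qed

lemma finite_associated_sets:
  assumes "numerical_semigroup S"
  shows "finite {T. numerical_set T \<and> atom_monoid T = S}"
proof (rule finite_subset)
  show "{T. numerical_set T \<and> atom_monoid T = S} \<subseteq> uminus ` Pow (- S)"
  proof
    fix T assume "T \<in> {T. numerical_set T \<and> atom_monoid T = S}"
    then have "S \<subseteq> T" by (force simp: numerical_set_def atom_monoid_def)
    then have "- T \<in> Pow (- S)" by auto
    then show "T \<in> uminus ` Pow (- S)" by (metis double_complement image_eqI)
  qed
  show "finite (uminus ` Pow (- S))"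
    using assms by (simp add: numerical_semigroup_def numerical_set_def)
qed

end

theory Submission
  imports Defs
begin

text \<open>
  Write \<open>m\<close> for the multiplicity and \<open>F\<close> for the Frobenius number. Maximal embedding dimension says
  that \<open>w - m\<close> is pseudo-Frobenius for every nonzero Apery element \<open>w\<close>, so above every gap there is
  a pseudo-Frobenius number in the same residue class modulo \<open>m\<close>. If \<open>x\<close> lies in the void,
  \<open>k \<ge> 0\<close>, and \<open>q\<close>, \<open>q - (x + k m)\<close> are both pseudo-Frobenius, then \<open>x + k m\<close> again lies in the void and
  triangle-freeness forces \<open>q = F\<close>. This rules out relations between distinct residue classes in the
  void poset, and it shows that the numerical sets with atom monoid \<open>S\<close> are the sets \<open>S \<union> I\<close> where
  \<open>I \<subseteq> M(S)\<close> is a union of full residue classes stable under \<open>x \<mapsto> F - x\<close>. Such sets correspond to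
  sets of orbits of \<open>i \<mapsto> F - i\<close> on the residues other than \<open>0\<close> and \<open>F\<close>.
\<close>

section \<open>Generating sets of submonoids of the naturals\<close>

lemma minimal_generating_subset:
  assumes "finite C" "submonoid hull C = S"
  shows "\<exists>A\<subseteq>C. minimal_generating_set S A"
  using assms
proof (induction C rule: finite_psubset_induct)
  case (psubset C)
  show ?case
  proof (cases "minimal_generating_set S C")
    case False
    then obtain B where B: "B \<subset> C" "submonoid hull B = S"
      using psubset.prems unfolding minimal_generating_set_def by blast
    then obtain A where "A \<subseteq> B" "minimal_generating_set S A"
      using psubset.IH[OF B] by blast
    then show ?thesis using B(1) by (intro exI[of _ A]) auto
  qed blast
qed

lemma hull_eq_if_decomposable:
  assumes S: "submonoid S" and "C \<subseteq> S"
    and dec: "\<And>c. c \<in> S \<Longrightarrow> c \<notin> C \<Longrightarrow> c \<noteq> 0 \<Longrightarrow> \<exists>a\<in>S - {0}. \<exists>b\<in>S - {0}. c = a + b"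
  shows "submonoid hull C = S"
proof
  show "submonoid hull C \<subseteq> S"
    using assms by (intro hull_minimal)
  show "S \<subseteq> submonoid hull C"
  proof
    fix x assume "x \<in> S"
    then show "x \<in> submonoid hull C"
    proof (induction x rule: less_induct)
      case (less x)
      show ?case
      proof (cases "x = 0 \<or> x \<in> C")
        case True
        then show ?thesis
          using submonoid_hull[of C] hull_subset[of C submonoid] unfolding submonoid_def by auto
      next
        case False
        then obtain a b where ab: "a \<in> S - {0}" "b \<in> S - {0}" "x = a + b"
          using dec less.prems by blast
        then have "a \<in> submonoid hull C" "b \<in> submonoid hull C"
          using less.IH by auto
        then show ?thesis
          using submonoid_hull[of C] ab(3) unfolding submonoid_def by blast
      qed
    qed
  qed
qed

lemma mod_diff_right_eq_iff_nat:
  fixes x y :: nat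
  assumes "x \<le> n" "y \<le> n"
  shows "(n - x) mod m = (n - y) mod m \<longleftrightarrow> x mod m = y mod m"
proof -
  \<comment> \<open>The same two multipliers, with their roles exchanged, witness both
    congruences.\<close>
  have "x + m * q1 = y + m * q2 \<longleftrightarrow> (n - x) + m * q2 = (n - y) + m * q1" for q1 q2
    using assms by linarith
  then show ?thesis unfolding nat_mod_eq_iff by metis
qed

section \<open>Numerical semigroups of maximal embedding dimension\<close>

locale med_semigroup =
  fixes S :: "nat set" and m F :: nat
  assumes semigroup: "numerical_semigroup S" and proper: "S \<noteq> UNIV"
    and med: "max_embedding_dimension S"
    and m_eq: "m = multiplicity_of S" and F_eq: "F = frobenius_number S"
begin

lemma zero_mem: "0 \<in> S"
  using semigroup by (simp add: numerical_semigroup_def numerical_set_def)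

lemma add_mem: "x \<in> S \<Longrightarrow> y \<in> S \<Longrightarrow> x + y \<in> S"
  using semigroup by (simp add: numerical_semigroup_def)

lemma finite_gaps: "finite (- S)"
  using semigroup by (simp add: numerical_semigroup_def numerical_set_def)

lemma submonoid_S: "submonoid S"
  using zero_mem add_mem by (simp add: submonoid_def)

lemma F_notin: "F \<notin> S"
  using Max_in[OF finite_gaps] proper unfolding F_eq frobenius_number_def by auto

lemma gap_le: "x \<notin> S \<Longrightarrow> x \<le> F"
  using Max_ge[OF finite_gaps] unfolding F_eq frobenius_number_def by auto

lemma m_mem: "m \<in> S" and m_pos: "m > 0" and m_le: "x \<in> S \<Longrightarrow> x \<noteq> 0 \<Longrightarrow> m \<le> x"
proof -
  have "Suc F \<in> S \<and> Suc F \<noteq> 0" using gap_le[of "Suc F"] by auto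
  then have "m \<in> S \<and> m \<noteq> 0"
    unfolding m_eq multiplicity_of_def by (rule LeastI)
  then show "m \<in> S" "m > 0" by auto
  show "m \<le> x" if "x \<in> S" "x \<noteq> 0"
    unfolding m_eq multiplicity_of_def using that by (intro Least_le) auto
qed

lemma mult_m_mem: "m * k \<in> S"
  by (induction k) (auto intro: add_mem m_mem zero_mem)

lemma add_mult_m_mem: "x \<in> S \<Longrightarrow> x + m * k \<in> S"
  by (intro add_mem mult_m_mem)

lemma mem_if_mod_eq:
  assumes "x \<in> S" "x \<le> y" "x mod m = y mod m"
  shows "y \<in> S"
proof -
  have "m dvd y - x" using assms mod_eq_dvd_iff_nat[of x y m] by simp
  then obtain k where "y = x + m * k" using assms(2) by (metis dvdE le_add_diff_inverse)
  then show ?thesis using add_mult_m_mem assms(1) by blast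
qed

text \<open>Otherwise dropping \<open>w + s\<close> from the \<open>m\<close>-element generating set \<open>B\<close> below, which consists of
  \<open>m\<close> and the nonzero Apery elements, would leave a generating set with fewer than \<open>m\<close> elements.\<close>

lemma add_diff_m_mem:
  assumes "w \<in> S" "w \<noteq> 0" "s \<in> S" "s \<noteq> 0"
  shows "w + s - m \<in> S"
proof (rule ccontr)
  assume notin: "w + s - m \<notin> S"
  define B where "B = {b \<in> S. b \<noteq> 0 \<and> (b = m \<or> b - m \<notin> S)}"
  have inj: "inj_on (\<lambda>b. b mod m) B"
  proof (rule linorder_inj_onI)
    fix x y assume xy: "x < y" "x \<in> B" "y \<in> B"
    then have x: "x \<in> S" "m \<le> x" and y: "y \<noteq> m" "y - m \<notin> S"
      using m_le[of x] zero_mem unfolding B_def by auto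
    \<comment> \<open>If \<open>x\<close> and \<open>y\<close> were congruent, \<open>y - m\<close>
      would be at least \<open>x\<close> in the same class, hence in \<open>S\<close>; and
      \<open>y = m\<close> is excluded by \<open>m \<le> x < y\<close>.\<close>
    show "x mod m \<noteq> y mod m"
    proof
      assume eq: "x mod m = y mod m"
      have "m dvd y - x" using eq xy(1) mod_eq_dvd_iff_nat[of x y m] by simp
      then have "x + m \<le> y" using xy(1) dvd_imp_le[of m "y - x"] by simp
      moreover have "(y - m) mod m = x mod m"
        using eq \<open>x + m \<le> y\<close> by (simp add: le_mod_geq)
      moreover have "x \<le> y - m" using \<open>x + m \<le> y\<close> by linarith
      ultimately show False using mem_if_mod_eq[of x "y - m"] x y by simp
    qed
  qed auto
  have img: "(\<lambda>b. b mod m) ` B \<subseteq> {..<m}" using m_pos by auto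
  have fin: "finite B" using inj img by (meson finite_imageD finite_lessThan finite_subset)
  have card: "card B \<le> m" using card_inj_on_le[OF inj img] by simp
  let ?C = "B - {w + s}"
  have "submonoid hull ?C = S"
  proof (rule hull_eq_if_decomposable[OF submonoid_S])
    show "?C \<subseteq> S" unfolding B_def by blast
    fix c assume c: "c \<in> S" "c \<notin> ?C" "c \<noteq> 0"
    show "\<exists>a\<in>S - {0}. \<exists>b\<in>S - {0}. c = a + b"
    proof (cases "c = w + s")
      case False
      then have "c \<noteq> m" "c - m \<in> S" "m \<le> c" using c m_le[of c] unfolding B_def by auto
      then show ?thesis using m_mem m_pos by (intro bexI[of _ m] bexI[of _ "c - m"]) auto
    qed (use assms in blast)
  qed
  then obtain A where A: "A \<subseteq> ?C" "minimal_generating_set S A"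
    using minimal_generating_subset fin by (meson finite_Diff)
  have "(THE A. minimal_generating_set S A) = A"
    using A(2) ex1_minimal_generating_set[OF semigroup] by (rule the1_equality[rotated])
  then have "card A = m"
    using med unfolding max_embedding_dimension_def embedding_dimension_def m_eq by simp
  moreover have "w + s \<in> B"
    using assms notin add_mem unfolding B_def by simp
  then have "card ?C < m"
    using card fin m_pos by (simp add: card_Diff_singleton)
  ultimately show False
    using card_mono[OF _ A(1)] fin by simp
qed

lemma pseudo_frobenius_diff_m:
  assumes "w \<in> S" "w - m \<notin> S"
  shows "w - m \<in> pseudo_frobenius S" "m \<le> w"
proof -
  have w: "w \<noteq> 0" using assms zero_mem by (metis diff_0_eq_0)
  then show "m \<le> w" using assms m_le by blast
  then have "w - m + s = w + s - m" for s by simp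
  then show "w - m \<in> pseudo_frobenius S"
    using assms w add_diff_m_mem unfolding pseudo_frobenius_def by auto
qed

text \<open>The largest gap in the class of \<open>x\<close> works: adding \<open>m\<close> to it
  gives the Apery element of that class, so \<open>pseudo_frobenius_diff_m\<close> applies.\<close>

lemma pseudo_frobenius_above:
  assumes "x \<notin> S"
  obtains k where "x + m * k \<in> pseudo_frobenius S"
proof -
  have "1 * Suc F \<le> m * Suc F" using m_pos by (intro mult_le_mono1) simp
  then have "F < m * Suc F" by (metis Suc_le_lessD mult_1)
  then have "F < x + m * Suc F" by (rule trans_less_add2)
  then have ex: "\<exists>k. x + m * k \<in> S" using gap_le by (meson not_le)
  define k where "k = (LEAST k. x + m * k \<in> S)"
  have k: "x + m * k \<in> S" unfolding k_def using ex by (rule LeastI_ex)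
  then have "k \<noteq> 0" using assms by (cases k) auto
  then obtain l where l: "k = Suc l" by (cases k) auto
  have "x + m * l \<notin> S" using not_less_Least[of l "\<lambda>k. x + m * k \<in> S"] l unfolding k_def by simp
  moreover have "x + m * k - m = x + m * l" unfolding l by simp
  ultimately have "x + m * l \<in> pseudo_frobenius S"
    using pseudo_frobenius_diff_m(1)[OF k] by simp
  then show ?thesis using that by blast
qed

section \<open>The void and its residue classes\<close>

lemma void_iff: "x \<in> void S \<longleftrightarrow> x \<notin> S \<and> F - x \<notin> S"
  by (simp add: void_def F_eq)

lemma F_notin_void: "F \<notin> void S"
  using zero_mem by (simp add: void_iff)

lemma void_notin: "x \<in> void S \<Longrightarrow> x \<notin> S"
  by (simp add: void_iff)

lemma void_le_F: "x \<in> void S \<Longrightarrow> x \<le> F"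
  by (simp add: void_iff gap_le)

lemma F_diff_void: "x \<in> void S \<Longrightarrow> F - x \<in> void S"
  using void_le_F[of x] by (simp add: void_iff)

text \<open>If \<open>F - (x + s)\<close> were in \<open>S\<close>, adding \<open>s\<close> would
  put \<open>F - x\<close> there too.\<close>

lemma void_add:
  assumes "x \<in> void S" "s \<in> S" "x + s \<notin> S"
  shows "x + s \<in> void S"
proof -
  have "x + s \<le> F" using assms gap_le by blast
  then have "F - x = (F - (x + s)) + s" by simp
  then have "F - (x + s) \<notin> S" using assms add_mem by (metis void_iff)
  then show ?thesis using assms by (simp add: void_iff)
qed

text \<open>Otherwise \<open>F - p\<close> would be a nonzero element of \<open>S\<close>, and
  \<open>F = p + (F - p)\<close> would lie in \<open>S\<close>.\<close>

lemma pseudo_frobenius_void: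
  assumes "p \<in> pseudo_frobenius S" "p \<noteq> F"
  shows "p \<in> void S"
proof -
  have p: "p \<notin> S" "\<forall>s\<in>S - {0}. p + s \<in> S"
    using assms unfolding pseudo_frobenius_def by auto
  then have "p < F" using assms gap_le[of p] by simp
  then have "F - p \<notin> S" using bspec[OF p(2), of "F - p"] F_notin by auto
  then show ?thesis using p by (simp add: void_iff)
qed

text \<open>Multiples of \<open>m\<close> are never gaps. The two residues have a sum congruent to
  \<open>F\<close> and below \<open>2 * m\<close>, which leaves two values.\<close>

lemma void_mod:
  assumes "x \<in> void S"
  shows "x mod m \<noteq> 0"
    "x mod m + (F - x) mod m = F mod m \<or> x mod m + (F - x) mod m = F mod m + m"
proof -
  have nz: "y mod m \<noteq> 0" if "y \<in> void S" for y
    using that mem_if_mod_eq[OF zero_mem, of y] void_notin by auto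
  show "x mod m \<noteq> 0" using nz assms .
  have "(x mod m + (F - x) mod m) mod m = F mod m"
    using void_le_F[OF assms] by (simp add: mod_add_eq)
  moreover have "x mod m < m" "(F - x) mod m < m" using m_pos by auto
  ultimately show "x mod m + (F - x) mod m = F mod m \<or> x mod m + (F - x) mod m = F mod m + m"
    by (cases "x mod m + (F - x) mod m < m") (auto simp: le_mod_geq)
qed

text \<open>Being positive and below the multiplicity, \<open>i\<close> is a gap; the
  pseudo-Frobenius number above it differs from \<open>F\<close> by its class, so it lies in the
  void.\<close>

lemma void_class_nonempty:
  assumes "i < m" "i \<noteq> 0" "i \<noteq> F mod m"
  obtains x where "x \<in> void S" "x mod m = i"
proof -
  have "i \<notin> S" using assms m_le by fastforce
  then obtain k where k: "i + m * k \<in> pseudo_frobenius S" using pseudo_frobenius_above by blast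
  moreover have eq: "(i + m * k) mod m = i" using assms by simp
  ultimately have "i + m * k \<in> void S" using pseudo_frobenius_void assms by metis
  then show ?thesis using that eq by blast
qed

end

section \<open>Consequences of triangle-freeness\<close>

locale triangle_free_med_semigroup = med_semigroup +
  assumes triangle_free: "triangle_free S"
begin

text \<open>The difference \<open>x + m * k\<close> is a gap, since adding a nonzero element of
  \<open>S\<close> to \<open>p\<close> would land in \<open>S\<close>. So it stays in the void and
  triangle-freeness applies.\<close>

lemma eq_F_if_pseudo_frobenius_diff:
  assumes x: "x \<in> void S" and p: "p \<in> pseudo_frobenius S" "p + x + m * k \<in> pseudo_frobenius S"
  shows "p + x + m * k = F"
proof -
  have nz: "x + m * k \<noteq> 0" using x zero_mem by (auto simp: void_iff)
  have "x + m * k \<notin> S"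
    using p nz unfolding pseudo_frobenius_def by (auto simp: add.assoc)
  then have "x + m * k \<in> void S" using void_add[OF x mult_m_mem] by simp
  then have "p + x + m * k - p \<in> void S" by (simp add: add.assoc)
  then show ?thesis
    using triangle_free p unfolding triangle_free_def F_eq by (metis add.assoc le_add1)
qed

text \<open>Suppose \<open>d = y - x\<close> is in \<open>S\<close> but not a multiple of
  \<open>m\<close>. The pseudo-Frobenius number in the class of \<open>d\<close> lies below
  \<open>d\<close>, so the one above \<open>y\<close> exceeds it by \<open>x\<close> plus a multiple
  of \<open>m\<close> and must be \<open>F\<close>. Then \<open>F - y\<close> is a multiple of
  \<open>m\<close>, hence in \<open>S\<close>.\<close>

lemma void_le_iff_dvd:
  assumes x: "x \<in> void S" and y: "y \<in> void S" and "x \<le> y"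
  shows "void_le S x y \<longleftrightarrow> m dvd (y - x)"
proof
  assume "m dvd (y - x)"
  then show "void_le S x y"
    using \<open>x \<le> y\<close> mult_m_mem unfolding void_le_def by (metis dvdE)
next
  assume le: "void_le S x y"
  define d where "d = y - x"
  have d: "d \<in> S" "y = x + d" using le unfolding void_le_def d_def by auto
  show "m dvd (y - x)"
  proof (rule ccontr)
    assume "\<not> m dvd (y - x)"
    then have r: "d mod m \<noteq> 0" unfolding d_def by (simp add: dvd_eq_mod_eq_0)
    have "d mod m \<notin> S" using r m_le[of "d mod m"] m_pos by (meson mod_less_divisor not_le)
    then obtain k where k: "d mod m + m * k \<in> pseudo_frobenius S"
      using pseudo_frobenius_above by blast
    have "d > d mod m + m * k"
    proof (rule ccontr)
      assume "\<not> d > d mod m + m * k"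
      then have "d mod m + m * k \<in> S" using mem_if_mod_eq[OF d(1)] by simp
      then show False using k unfolding pseudo_frobenius_def by blast
    qed
    then have "m * k < m * (d div m)" using mult_div_mod_eq[of m d] by linarith
    then have kl: "k \<le> d div m" by simp
    obtain l where l: "y + m * l \<in> pseudo_frobenius S"
      using pseudo_frobenius_above void_notin[OF y] by blast
    have "d = d mod m + m * k + m * (d div m - k)"
      using kl mult_div_mod_eq[of m d] by (simp add: diff_mult_distrib2)
    then have "y + m * l = (d mod m + m * k) + x + m * (d div m - k + l)"
      unfolding d(2) by (simp add: distrib_left)
    then have "y + m * l = F"
      using eq_F_if_pseudo_frobenius_diff[OF x k] l by metis
    then have "F - y = m * l" by simp
    then show False using y mult_m_mem by (metis void_iff)
  qed
qed

section \<open>Numerical sets with atom monoid \<open>S\<close>\<close>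

definition saturated :: "nat set \<Rightarrow> bool" where
  "saturated I \<longleftrightarrow> I \<subseteq> void S \<and>
     (\<forall>x\<in>I. \<forall>y\<in>void S. y mod m = x mod m \<or> y mod m = (F - x) mod m \<longrightarrow> y \<in> I)"

text \<open>By \<open>void_le_iff_dvd\<close>, adding \<open>s \<in> S\<close> to a point of
  \<open>I\<close> either lands in \<open>S\<close> or keeps the class. An atom \<open>a\<close>
  outside \<open>S\<close> would lie in \<open>I\<close> together with \<open>F - a\<close>, forcing
  \<open>F\<close> into \<open>S \<union> I\<close>.\<close>

lemma associated_if_saturated:
  assumes I: "saturated I"
  shows "numerical_set (S \<union> I)" "atom_monoid (S \<union> I) = S"
proof -
  have sub: "I \<subseteq> void S" using I unfolding saturated_def by blast
  show "numerical_set (S \<union> I)"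
    using zero_mem finite_gaps unfolding numerical_set_def by (auto intro: finite_subset)
  show "atom_monoid (S \<union> I) = S"
  proof
    show "S \<subseteq> atom_monoid (S \<union> I)"
    proof
      fix s assume s: "s \<in> S"
      have "s + x \<in> S \<union> I" if x: "x \<in> I" for x
      proof (cases "x + s \<in> S")
        case False
        have xv: "x \<in> void S" using sub x by blast
        have v: "x + s \<in> void S" using void_add xv s False by blast
        have "m dvd s" using void_le_iff_dvd[OF xv v] s by (simp add: void_le_def)
        then have "(x + s) mod m = x mod m" by (metis dvdE mod_mult_self2)
        then have "x + s \<in> I" using I x v unfolding saturated_def by blast
        then show ?thesis by (simp add: add.commute)
      qed (simp add: add.commute)
      then show "s \<in> atom_monoid (S \<union> I)"
        using s add_mem unfolding atom_monoid_def by auto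
    qed
    show "atom_monoid (S \<union> I) \<subseteq> S"
    proof (rule subsetI, rule ccontr)
      fix a assume a: "a \<in> atom_monoid (S \<union> I)" "a \<notin> S"
      then have cl: "a + t \<in> S \<union> I" if "t \<in> S \<union> I" for t
        using that unfolding atom_monoid_def by blast
      have "a \<in> I" using cl[of 0] zero_mem a(2) by simp
      then have "a \<in> void S" using sub by blast
      then have "F - a \<in> I"
        using I \<open>a \<in> I\<close> F_diff_void unfolding saturated_def by blast
      then have "a + (F - a) \<in> S \<union> I" using cl by blast
      then have "F \<in> S \<union> I" using void_le_F[OF \<open>a \<in> void S\<close>] by simp
      then show False using F_notin F_notin_void sub by blast
    qed
  qed
qed

lemma saturated_if_associated:
  assumes T: "numerical_set T" "atom_monoid T = S"
  shows "S \<subseteq> T" "saturated (T - S)"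
proof -
  have closed: "s + t \<in> T" if "s \<in> S" "t \<in> T" for s t
    using that T unfolding atom_monoid_def by blast
  have zero: "0 \<in> T" using T unfolding numerical_set_def by blast
  show "S \<subseteq> T" using closed[OF _ zero] by auto
  have up: "y \<in> T" if "x \<in> T" "x \<le> y" "x mod m = y mod m" for x y
  proof -
    have "m dvd y - x" using that mod_eq_dvd_iff_nat[of x y m] by simp
    then have "y - x \<in> S" using mult_m_mem by (metis dvdE)
    then show ?thesis using closed[OF _ \<open>x \<in> T\<close>, of "y - x"] that by simp
  qed
  have F: "F \<notin> T"
  proof
    assume "F \<in> T"
    \<comment> \<open>Every nonzero \<open>t\<close> pushes \<open>F\<close> beyond the largest gap,
      so \<open>F\<close> would be an atom.\<close>
    then have "F + t \<in> T" if "t \<in> T" for t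
      using that gap_le[of "F + t"] \<open>S \<subseteq> T\<close> by (cases "t = 0") auto
    then have "F \<in> atom_monoid T" unfolding atom_monoid_def by blast
    then show False using T F_notin by simp
  qed
  have void: "x \<in> void S" if "x \<in> T" "x \<notin> S" for x
  proof -
    have "F - x \<notin> S" using closed[of "F - x" x] that gap_le[of x] F by auto
    then show ?thesis using that by (simp add: void_iff)
  qed
  text \<open>Witnesses \<open>u\<close> to \<open>p \<notin> A(T)\<close>, with \<open>p\<close> the pseudo-Frobenius number above \<open>x\<close>, lie in the
    class of \<open>F - x\<close>, below all void elements of that class.\<close>
  have key: "\<exists>u\<in>T - S. u mod m = (F - x) mod m \<and>
      (\<forall>y\<in>void S. y mod m = (F - x) mod m \<longrightarrow> u \<le> y)" if x: "x \<in> T - S" for x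
  proof -
    obtain k where p: "x + m * k \<in> pseudo_frobenius S" (is "?p \<in> _")
      using pseudo_frobenius_above x by blast
    have pT: "?p \<in> T" using up[of x ?p] x by simp
    have pS: "?p \<notin> S" using p unfolding pseudo_frobenius_def by blast
    then obtain u where u: "u \<in> T" "?p + u \<notin> T"
      using T unfolding atom_monoid_def by blast
    have "u \<noteq> 0" using u(2) pT by (metis add_0_right)
    then have uS: "u \<notin> S" using p u \<open>S \<subseteq> T\<close> unfolding pseudo_frobenius_def by blast
    have puS: "?p + u \<notin> S" using u \<open>S \<subseteq> T\<close> by blast
    obtain l where q: "?p + u + m * l \<in> pseudo_frobenius S"
      using pseudo_frobenius_above[OF puS] by blast
    have eq: "?p + u + m * l = F"
      using eq_F_if_pseudo_frobenius_diff[OF void[OF u(1) uS] p q] .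
    have "F - x = u + m * (k + l)" using eq by (simp add: distrib_left)
    then have um: "u mod m = (F - x) mod m" by simp
    \<comment> \<open>If \<open>y < u\<close>, then \<open>F - y\<close> exceeds \<open>?p\<close>
      by a positive multiple of \<open>m\<close>, so it lies in \<open>S\<close> because
      \<open>?p\<close> is pseudo-Frobenius; but \<open>y\<close> is in the void.\<close>
    have "u \<le> y" if y: "y \<in> void S" "y mod m = (F - x) mod m" for y
    proof (rule ccontr)
      assume "\<not> u \<le> y"
      have xF: "x \<le> F" using x gap_le by blast
      have "(F - y) mod m = (F - (F - x)) mod m"
        using mod_diff_right_eq_iff_nat[of y F "F - x"] y(2) void_le_F[OF y(1)] by simp
      then have c: "(F - y) mod m = x mod m" using xF by simp
      have "?p < F - y" using \<open>\<not> u \<le> y\<close> eq by linarith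
      moreover have "?p mod m = (F - y) mod m" using c by simp
      ultimately have "m dvd F - y - ?p" using mod_eq_dvd_iff_nat[of ?p "F - y" m] by simp
      then obtain j where "F - y - ?p = m * j" ..
      then have j: "F - y = ?p + m * j" "j > 0"
        using \<open>?p < F - y\<close> by (auto intro: gr0I)
      then have "?p + m * j \<in> S"
        using p mult_m_mem[of j] m_pos unfolding pseudo_frobenius_def by auto
      then show False using y(1) j by (simp add: void_iff)
    qed
    then show ?thesis using u(1) uS um by blast
  qed
  have refl_closed: "y \<in> T - S"
    if x: "x \<in> T - S" and y: "y \<in> void S" "y mod m = (F - x) mod m" for x y
  proof -
    obtain u where u: "u \<in> T - S" "u mod m = (F - x) mod m" "u \<le> y" using key[OF x] y by blast
    then have "y \<in> T" using up[of u y] y(2) by simp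
    then show ?thesis using y(1) void_notin by blast
  qed
  \<comment> \<open>Reflecting twice, first to \<open>u\<close> and then by
    \<open>refl_closed\<close> at \<open>u\<close>, returns to the class of
    \<open>x\<close>.\<close>
  have class_closed: "y \<in> T - S"
    if x: "x \<in> T - S" and y: "y \<in> void S" "y mod m = x mod m" for x y
  proof -
    obtain u where u: "u \<in> T - S" "u mod m = (F - x) mod m" using key[OF x] by blast
    have le: "u \<le> F" "x \<le> F" using u x gap_le by auto
    have "(F - u) mod m = (F - (F - x)) mod m"
      using mod_diff_right_eq_iff_nat[of u F "F - x"] u(2) le by simp
    then have "y mod m = (F - u) mod m" using y(2) le by simp
    then show ?thesis using refl_closed[OF u(1) y(1)] by blast
  qed
  show "saturated (T - S)"
    unfolding saturated_def using void refl_closed class_closed by blast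
qed

text \<open>The involution \<open>i \<mapsto> F - i\<close> reflects each of the intervals of residues \<open>{1..<f}\<close> and
  \<open>{f<..<m}\<close>, where \<open>f = F mod m\<close>; the lower halves represent its orbits.\<close>

definition reps :: "nat set" where
  "reps = {1..F mod m div 2} \<union> {F mod m + 1..(m + F mod m) div 2}"

lemma card_reps: "card reps = F mod m div 2 + ((m + F mod m) div 2 - F mod m)"
  unfolding reps_def by (subst card_Un_disjoint) auto

lemma reps_void_class:
  assumes "i \<in> reps"
  obtains x where "x \<in> void S" "x mod m = i"
proof -
  have "F mod m < m" using m_pos by simp
  then have "i < m" "i \<noteq> 0" "i \<noteq> F mod m" using assms unfolding reps_def by auto
  then show ?thesis using void_class_nonempty that by blast
qed

text \<open>Of two residues with sum \<open>F mod m\<close> or \<open>F mod m + m\<close>, the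
  smaller is in the lower half of its interval; both are only at the midpoint.\<close>

lemma void_mod_reps:
  assumes "x \<in> void S"
  shows "x mod m \<in> reps \<or> (F - x) mod m \<in> reps"
    "x mod m \<in> reps \<Longrightarrow> (F - x) mod m \<in> reps \<Longrightarrow> x mod m = (F - x) mod m"
proof -
  define i j f where "i = x mod m" and "j = (F - x) mod m" and "f = F mod m"
  have "i > 0" "j > 0" "i + j = f \<or> i + j = f + m"
    using void_mod[OF assms] void_mod(1)[OF F_diff_void[OF assms]]
    unfolding i_def j_def f_def by auto
  moreover have "i < m" "j < m" "f < m" using m_pos unfolding i_def j_def f_def by auto
  ultimately have "(i \<in> reps \<or> j \<in> reps) \<and> (i \<in> reps \<longrightarrow> j \<in> reps \<longrightarrow> i = j)"
    unfolding reps_def f_def[symmetric] by auto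
  then show "x mod m \<in> reps \<or> (F - x) mod m \<in> reps"
    "x mod m \<in> reps \<Longrightarrow> (F - x) mod m \<in> reps \<Longrightarrow> x mod m = (F - x) mod m"
    unfolding i_def j_def by auto
qed

section \<open>Parametrization by sets of orbit representatives\<close>

definition assoc_of :: "nat set \<Rightarrow> nat set" where
  "assoc_of D = S \<union> {x \<in> void S. x mod m \<in> D \<or> (F - x) mod m \<in> D}"

text \<open>A void element with residue \<open>i\<close> detects whether \<open>i\<close> or its
  reflection was selected, and two representatives of one orbit coincide.\<close>

lemma inj_on_assoc_of: "inj_on assoc_of (Pow reps)"
proof (rule inj_onI)
  have sub: "D \<subseteq> E" if D: "D \<subseteq> reps" and E: "E \<subseteq> reps" and eq: "assoc_of D = assoc_of E" for D E
  proof
    fix i assume i: "i \<in> D"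
    then obtain x where x: "x \<in> void S" "x mod m = i" using reps_void_class D by blast
    then have "x \<in> assoc_of E" using i eq unfolding assoc_of_def by blast
    then have "x mod m \<in> E \<or> (F - x) mod m \<in> E"
      using void_notin[OF x(1)] unfolding assoc_of_def by blast
    then show "i \<in> E" using void_mod_reps(2)[OF x(1)] x(2) i D E by (metis subsetD)
  qed
  fix D E assume "D \<in> Pow reps" "E \<in> Pow reps" "assoc_of D = assoc_of E"
  then show "D = E" using sub[of D E] sub[of E D] by auto
qed

lemma void_reflect_mod:
  assumes "x \<in> void S" "y \<in> void S" "y mod m = (F - x) mod m"
  shows "(F - y) mod m = x mod m"
  using mod_diff_right_eq_iff_nat[of y F "F - x"] assms void_le_F[of x] void_le_F[of y] by simp

lemma image_assoc_of: "assoc_of ` Pow reps = {T. numerical_set T \<and> atom_monoid T = S}"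
proof (intro equalityI subsetI)
  fix T assume "T \<in> assoc_of ` Pow reps"
  then obtain D where D: "T = assoc_of D" by blast
  have "y \<in> {x \<in> void S. x mod m \<in> D \<or> (F - x) mod m \<in> D}"
    if x: "x \<in> void S" "x mod m \<in> D \<or> (F - x) mod m \<in> D" and y: "y \<in> void S"
      and mod: "y mod m = x mod m \<or> y mod m = (F - x) mod m" for x y
    using mod
  proof
    assume eq: "y mod m = x mod m"
    then have "(F - y) mod m = (F - x) mod m"
      using mod_diff_right_eq_iff_nat void_le_F x(1) y by blast
    then show ?thesis using x y eq by simp
  next
    assume eq: "y mod m = (F - x) mod m"
    then show ?thesis using void_reflect_mod[OF x(1) y eq] x y by auto
  qed
  then have "saturated {x \<in> void S. x mod m \<in> D \<or> (F - x) mod m \<in> D}"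
    unfolding saturated_def by blast
  then show "T \<in> {T. numerical_set T \<and> atom_monoid T = S}"
    using associated_if_saturated unfolding D assoc_of_def by blast
next
  fix T assume "T \<in> {T. numerical_set T \<and> atom_monoid T = S}"
  then have ST: "S \<subseteq> T" and sat: "saturated (T - S)" using saturated_if_associated by auto
  \<comment> \<open>An orbit is selected when its representative occurs as a residue in
    \<open>T - S\<close>.\<close>
  define D where "D = reps \<inter> (\<lambda>x. x mod m) ` (T - S)"
  have sub: "T - S \<subseteq> void S" using sat unfolding saturated_def by blast
  have "x \<in> T - S \<longleftrightarrow> x \<in> void S \<and> (x mod m \<in> D \<or> (F - x) mod m \<in> D)" for x
  proof
    assume x: "x \<in> T - S"
    then have v: "x \<in> void S" using sub by blast
    then have "F - x \<in> T - S" using sat x F_diff_void unfolding saturated_def by blast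
    then show "x \<in> void S \<and> (x mod m \<in> D \<or> (F - x) mod m \<in> D)"
      using void_mod_reps(1)[OF v] x v unfolding D_def by blast
  next
    assume x: "x \<in> void S \<and> (x mod m \<in> D \<or> (F - x) mod m \<in> D)"
    then obtain y where y: "y \<in> T - S" "x mod m = y mod m \<or> y mod m = (F - x) mod m"
      unfolding D_def by (metis IntE imageE)
    then have "y \<in> void S" using sub by blast
    then have "x mod m = y mod m \<or> x mod m = (F - y) mod m"
      using y(2) void_reflect_mod x by metis
    then show "x \<in> T - S" using sat y(1) x unfolding saturated_def by blast
  qed
  then have "T - S = {x \<in> void S. x mod m \<in> D \<or> (F - x) mod m \<in> D}" by blast
  then have "T = assoc_of D" using ST unfolding assoc_of_def by blast
  moreover have "D \<in> Pow reps" unfolding D_def by blast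
  ultimately show "T \<in> assoc_of ` Pow reps" by blast
qed

lemma num_associated_sets_eq:
  "num_associated_sets S = 2 ^ (F mod m div 2 + ((m + F mod m) div 2 - F mod m))"
proof -
  have "finite reps" unfolding reps_def by simp
  then have "card (assoc_of ` Pow reps) = 2 ^ card reps"
    using card_image[OF inj_on_assoc_of] by (simp add: card_Pow)
  then show ?thesis
    unfolding num_associated_sets_def image_assoc_of[symmetric] card_reps .
qed

end

theorem theorem8p2:
  fixes S :: "nat set" and m F :: nat
  assumes "numerical_semigroup S" and "S \<noteq> UNIV"
    and "triangle_free S" and "max_embedding_dimension S"
    and "m = multiplicity_of S" and "F = frobenius_number S"
  shows "(\<forall>x\<in>void S. \<forall>y\<in>void S. x \<le> y \<longrightarrow> (void_le S x y \<longleftrightarrow> m dvd (y - x)))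
    \<and> (odd m \<longrightarrow> num_associated_sets S = 2 ^ ((m - 1) div 2))
    \<and> (even m \<and> odd F \<longrightarrow> num_associated_sets S = 2 ^ ((m - 2) div 2))
    \<and> (even m \<and> even F \<longrightarrow> num_associated_sets S = 2 ^ (m div 2))"
proof -
  interpret triangle_free_med_semigroup S m F
    using assms by unfold_locales
  define f where "f = F mod m"
  have "f < m" using m_pos unfolding f_def by simp
  have parity: "even f = even F" if "even m"
    using that unfolding f_def by (simp add: dvd_mod_iff)
  \<comment> \<open>The residues fixed by the involution are \<open>f / 2\<close> and
    \<open>(m + f) / 2\<close> when integral: one for odd \<open>m\<close>; for even
    \<open>m\<close>, none if \<open>f\<close> is odd and two if \<open>f\<close> is even.\<close>
  have "f div 2 + ((m + f) div 2 - f) = (m - 1) div 2" if "odd m"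
    using that \<open>f < m\<close> by (cases "even f") (auto elim!: evenE oddE)
  moreover have "f div 2 + ((m + f) div 2 - f) = (m - 2) div 2" if "even m" "odd f"
    using that \<open>f < m\<close> by (auto elim!: evenE oddE)
  moreover have "f div 2 + ((m + f) div 2 - f) = m div 2" if "even m" "even f"
    using that \<open>f < m\<close> by (auto elim!: evenE oddE)
  ultimately show ?thesis
    using void_le_iff_dvd num_associated_sets_eq parity unfolding f_def by simp
qed

end
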